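(* Let $\mathcal I\subsetneq\mathcal J$ be proper ideals on $\mathbb N$ such that $\mathcal I$ is everywhere meager. Then $c_{0,\mathcal I}$ is not complemented in $c_{0,\mathcal J}$. In particular, $c_0$ is not complemented in $c_{0,\mathcal J}$ for any ideal $\mathcal J\supsetneq\mathsf{Fin}$ on $\mathbb N$.
   Context: An ideal on $\mathbb N$ is a family of subsets of $\mathbb N$ containing $\emptyset$ and closed under subsets and finite unions; every ideal is assumed to contain all finite sets, and is proper if it is not $\mathcal P(\mathbb N)$. $\mathsf{Fin}$ is the ideal of finite subsets of $\mathbb N$. $\mathcal I\restriction A=\{A\cap B:B\in\mathcal I\}$. $\mathcal I$ is everywhere meager if for every $A\subseteq\mathbb N$ with $A\notin\mathcal I$, $\mathcal I\restriction A$ is a meager subset of $2^A=\{0,1\}^A$ (product topology, sets identified with characteristic functions). $c_{0,\mathcal I}$ is the closed subspace of $\ell_\infty$ of all bounded scalar sequences $(x_n)$ with $\{n:|x_n|\ge\varepsilon\}\in\mathcal I$ for every $\varepsilon>0$; $c_0=c_{0,\mathsf{Fin}}$. A closed subspace $E$ of a Banach space $X$ is complemented in $X$ if there is a bounded linear projection from $X$ onto $E$. *)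

theory Defs
  imports "HOL-Analysis.Analysis"
begin

section \<open>Ideals on the natural numbers\<close>

definition nat_ideal :: "nat set set \<Rightarrow> bool" where
  "nat_ideal I \<longleftrightarrow>
     {} \<in> I \<and>
     (\<forall>A B. A \<in> I \<and> B \<subseteq> A \<longrightarrow> B \<in> I) \<and>
     (\<forall>A B. A \<in> I \<and> B \<in> I \<longrightarrow> A \<union> B \<in> I) \<and>
     (\<forall>A. finite A \<longrightarrow> A \<in> I)"

lemma nat_idealD:
  assumes "nat_ideal I"
  shows "{} \<in> I"
    and "A \<in> I \<Longrightarrow> B \<subseteq> A \<Longrightarrow> B \<in> I"
    and "A \<in> I \<Longrightarrow> B \<in> I \<Longrightarrow> A \<union> B \<in> I"
  using assms unfolding nat_ideal_def by blast+

definition proper_nat_ideal :: "nat set set \<Rightarrow> bool" where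
  "proper_nat_ideal I \<longleftrightarrow> nat_ideal I \<and> I \<noteq> UNIV"

definition Fin :: "nat set set" where
  "Fin = {A. finite A}"

definition restrict_ideal :: "nat set set \<Rightarrow> nat set \<Rightarrow> nat set set" where
  "restrict_ideal I A = {A \<inter> B | B. B \<in> I}"


section \<open>Everywhere meager ideals\<close>

definition nowhere_dense_in :: "'a topology \<Rightarrow> 'a set \<Rightarrow> bool" where
  "nowhere_dense_in T S \<longleftrightarrow>
     S \<subseteq> topspace T \<and> T interior_of (T closure_of S) = {}"

definition meager_in :: "'a topology \<Rightarrow> 'a set \<Rightarrow> bool" where
  "meager_in T S \<longleftrightarrow>
     (\<exists>F. countable F \<and> (\<forall>C\<in>F. nowhere_dense_in T C) \<and> S = \<Union>F)"

definition cantor_space :: "nat set \<Rightarrow> (nat \<Rightarrow> bool) topology" where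
  "cantor_space A = product_topology (\<lambda>_. discrete_topology UNIV) A"

text \<open>The points of \<^term>\<open>cantor_space A\<close> are the extensional functions on \<open>A\<close>,
  so a characteristic function has to be cut down to \<open>A\<close> by \<^const>\<open>restrict\<close>.\<close>

definition char_fun :: "nat set \<Rightarrow> nat set \<Rightarrow> nat \<Rightarrow> bool" where
  "char_fun A B = restrict (\<lambda>n. n \<in> B) A"

lemma char_fun_bij: "bij_betw (char_fun A) (Pow A) (topspace (cantor_space A))"
proof (rule bij_betw_byWitness[where f' = "\<lambda>f. {n \<in> A. f n}"])
  show "\<forall>B\<in>Pow A. {n \<in> A. char_fun A B n} = B"
    by (auto simp: char_fun_def)
  show "\<forall>f\<in>topspace (cantor_space A). char_fun A {n \<in> A. f n} = f"
    by (auto simp: char_fun_def cantor_space_def fun_eq_iff PiE_iff extensional_def)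
qed (auto simp: char_fun_def cantor_space_def)

definition everywhere_meager :: "nat set set \<Rightarrow> bool" where
  "everywhere_meager I \<longleftrightarrow>
     (\<forall>A. A \<notin> I \<longrightarrow> meager_in (cantor_space A) (char_fun A ` restrict_ideal I A))"


section \<open>The spaces of bounded sequences that vanish along an ideal\<close>

text \<open>As \<^typ>\<open>nat\<close> is discrete, \<^typ>\<open>nat \<Rightarrow>\<^sub>C 'k\<close> is the space of all bounded
  \<open>'k\<close>-valued sequences with the supremum norm. The scalar field \<open>'k\<close> is a complete normed
  field over the reals, so it is either the reals or the complex numbers (Gelfand--Mazur).
  The library provides only real scalar multiplication on this space.\<close>

definition linf_scale ::
    "'k::real_normed_field \<Rightarrow> (nat \<Rightarrow>\<^sub>C 'k) \<Rightarrow> (nat \<Rightarrow>\<^sub>C 'k)" where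
  "linf_scale c x = Bcontfun (\<lambda>n. c * apply_bcontfun x n)"

lemma apply_linf_scale [simp]:
  "apply_bcontfun (linf_scale c x) n = c * apply_bcontfun x n"
proof -
  obtain b where b: "\<And>n. norm (apply_bcontfun x n) \<le> b"
    using bounded_apply_bcontfun[of x] by (auto simp: bounded_iff)
  have "norm (c * apply_bcontfun x n) \<le> norm c * b" for n
    by (simp add: norm_mult mult_left_mono b)
  then have "(\<lambda>n. c * apply_bcontfun x n) \<in> bcontfun"
    by (auto simp: bcontfun_def bounded_iff)
  then show ?thesis
    by (simp add: linf_scale_def Bcontfun_inverse)
qed

interpretation linf: vector_space "linf_scale :: 'k::real_normed_field \<Rightarrow> _"
  by unfold_locales (rule bcontfun_eqI, simp add: algebra_simps)+

definition c0_ideal :: "nat set set \<Rightarrow> (nat \<Rightarrow>\<^sub>C 'k::real_normed_field) set" where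
  "c0_ideal I = {x. \<forall>\<epsilon>>0. {n. norm (apply_bcontfun x n) \<ge> \<epsilon>} \<in> I}"

lemma c0_ideal_mono: "I \<subseteq> J \<Longrightarrow> c0_ideal I \<subseteq> c0_ideal J"
  by (auto simp: c0_ideal_def)

lemma c0_ideal_Fin: "x \<in> c0_ideal Fin \<longleftrightarrow> apply_bcontfun x \<longlonglongrightarrow> 0"
  unfolding c0_ideal_def Fin_def tendsto_iff cofinite_eq_sequentially[symmetric] eventually_cofinite
  by (simp add: not_less)

lemma c0_ideal_subspace:
  assumes I: "nat_ideal I"
  shows "linf.subspace (c0_ideal I)"
proof (rule linf.subspaceI)
  show "0 \<in> c0_ideal I"
    using nat_idealD(1)[OF I] by (simp add: c0_ideal_def)
next
  fix x y :: "nat \<Rightarrow>\<^sub>C 'a"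
  assume xy: "x \<in> c0_ideal I" "y \<in> c0_ideal I"
  have "{n. norm (apply_bcontfun (x + y) n) \<ge> \<epsilon>} \<in> I" if "\<epsilon> > 0" for \<epsilon>
  proof -
    have "{n. norm (apply_bcontfun x n) \<ge> \<epsilon>/2} \<union> {n. norm (apply_bcontfun y n) \<ge> \<epsilon>/2} \<in> I"
      using xy half_gt_zero[OF that] unfolding c0_ideal_def
      by (intro nat_idealD(3)[OF I]) blast+
    moreover have "{n. norm (apply_bcontfun (x + y) n) \<ge> \<epsilon>}
        \<subseteq> {n. norm (apply_bcontfun x n) \<ge> \<epsilon>/2} \<union> {n. norm (apply_bcontfun y n) \<ge> \<epsilon>/2}"
    proof
      fix n
      assume "n \<in> {n. norm (apply_bcontfun (x + y) n) \<ge> \<epsilon>}"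
      moreover have "norm (apply_bcontfun x n + apply_bcontfun y n)
          \<le> norm (apply_bcontfun x n) + norm (apply_bcontfun y n)"
        by (rule norm_triangle_ineq)
      ultimately show "n \<in> {n. norm (apply_bcontfun x n) \<ge> \<epsilon>/2} \<union> {n. norm (apply_bcontfun y n) \<ge> \<epsilon>/2}"
        by (auto simp: plus_bcontfun.rep_eq)
    qed
    ultimately show ?thesis
      by (rule nat_idealD(2)[OF I])
  qed
  then show "x + y \<in> c0_ideal I"
    by (auto simp: c0_ideal_def)
next
  fix c :: 'a and x :: "nat \<Rightarrow>\<^sub>C 'a"
  assume x: "x \<in> c0_ideal I"
  show "linf_scale c x \<in> c0_ideal I"
  proof (cases "c = 0")
    case True
    then show ?thesis
      using nat_idealD(1)[OF I] by (simp add: c0_ideal_def)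
  next
    case False
    then have "{n. norm (apply_bcontfun (linf_scale c x) n) \<ge> \<epsilon>}
        = {n. norm (apply_bcontfun x n) \<ge> \<epsilon> / norm c}" for \<epsilon>
      by (auto simp: norm_mult field_simps)
    with x False show ?thesis
      by (auto simp: c0_ideal_def)
  qed
qed

lemma c0_ideal_closed:
  assumes I: "nat_ideal I"
  shows "closed (c0_ideal I :: (nat \<Rightarrow>\<^sub>C 'a::real_normed_field) set)"
proof -
  have "x \<in> c0_ideal I" if x: "x \<in> closure (c0_ideal I)" for x :: "nat \<Rightarrow>\<^sub>C 'a"
  proof -
    have "{n. norm (apply_bcontfun x n) \<ge> \<epsilon>} \<in> I" if "\<epsilon> > 0" for \<epsilon>
    proof -
      obtain y where y: "y \<in> c0_ideal I" "dist y x < \<epsilon>/2"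
        using x \<open>\<epsilon> > 0\<close> half_gt_zero[of \<epsilon>] unfolding closure_approachable by blast
      have "{n. norm (apply_bcontfun x n) \<ge> \<epsilon>} \<subseteq> {n. norm (apply_bcontfun y n) \<ge> \<epsilon>/2}"
      proof
        fix n
        assume n: "n \<in> {n. norm (apply_bcontfun x n) \<ge> \<epsilon>}"
        have "norm (apply_bcontfun x n) - norm (apply_bcontfun y n)
            \<le> norm (apply_bcontfun x n - apply_bcontfun y n)"
          by (rule norm_triangle_ineq2)
        also have "\<dots> < \<epsilon>/2"
          using dist_fun_lt_imp_dist_val_lt[OF y(2), of n]
          by (simp add: dist_norm norm_minus_commute)
        finally show "n \<in> {n. norm (apply_bcontfun y n) \<ge> \<epsilon>/2}"
          using n by auto
      qed
      moreover have "{n. norm (apply_bcontfun y n) \<ge> \<epsilon>/2} \<in> I"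
        using y(1) half_gt_zero[OF \<open>\<epsilon> > 0\<close>] unfolding c0_ideal_def by blast
      ultimately show ?thesis
        by (rule nat_idealD(2)[OF I, rotated])
    qed
    then show ?thesis
      by (auto simp: c0_ideal_def)
  qed
  then have "closure (c0_ideal I :: (nat \<Rightarrow>\<^sub>C 'a) set) \<subseteq> c0_ideal I"
    by blast
  then show ?thesis
    by (simp add: closure_subset_eq)
qed


section \<open>Complemented subspaces\<close>

text \<open>The projection is represented by a total function whose values outside \<open>X\<close> are
  irrelevant. Linearity is over the full scalar field, via the given scalar multiplication.
  The definition is meant for closed subspaces \<open>E \<subseteq> X\<close>, see \<open>c0_ideal_mono\<close>,
  \<open>c0_ideal_subspace\<close> and \<open>c0_ideal_closed\<close>.\<close>

definition complemented_in ::
    "('k::field \<Rightarrow> 'v::real_normed_vector \<Rightarrow> 'v) \<Rightarrow> 'v set \<Rightarrow> 'v set \<Rightarrow> bool" where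
  "complemented_in smul E X \<longleftrightarrow>
     (\<exists>P. (\<forall>x\<in>X. \<forall>y\<in>X. P (x + y) = P x + P y) \<and>
          (\<forall>c. \<forall>x\<in>X. P (smul c x) = smul c (P x)) \<and>
          (\<exists>K. \<forall>x\<in>X. norm (P x) \<le> K * norm x) \<and>
          (\<forall>x\<in>X. P (P x) = P x) \<and>
          P ` X = E)"

end

theory Submission
  imports Defs
begin

text \<open>
  The argument follows Whitley's proof that \<open>c\<^sub>0\<close> is not complemented in \<open>\<ell>\<^sub>\<infinity>\<close>. Suppose that \<open>P\<close>
  projects \<open>c0_ideal J\<close> onto \<open>c0_ideal I\<close>, and let \<open>Q x = x - P x\<close>, a bounded operator that
  vanishes on \<open>c0_ideal I\<close>. Suppose further that \<open>B\<^sub>r\<close> is an uncountable family of sets in \<open>J\<close>,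
  none of them in \<open>I\<close>, any two distinct ones of which meet in a set of \<open>I\<close>. Finitely many of the \<open>B\<^sub>r\<close> can be
  made disjoint by removing sets of \<open>I\<close>, which does not change the value of \<open>Q\<close> at their
  indicators. A combination of disjoint indicators with coefficients of modulus one has norm at
  most one, so at each coordinate \<open>n\<close> the numbers \<open>|Q(1\<^bsub>B\<^sub>r\<^esub>)(n)|\<close> have bounded finite sums and
  only countably many of them are nonzero. There are countably many coordinates, so
  \<open>Q(1\<^bsub>B\<^sub>r\<^esub>) = 0\<close> for some \<open>r\<close>. Then \<open>1\<^bsub>B\<^sub>r\<^esub>\<close> lies in the range \<open>c0_ideal I\<close> of \<open>P\<close>, so \<open>B\<^sub>r \<in> I\<close>, a
  contradiction. This part is \<open>vanishing_operator_kills_almost_disjoint_member\<close> and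
  \<open>not_complemented_if_blocks\<close>.

  The family is obtained inside a set \<open>A\<close> of \<open>J\<close> outside \<open>I\<close>. It suffices to find
  disjoint finite subsets \<open>s\<^sub>0, s\<^sub>1, \<dots>\<close> of \<open>A\<close> such that no union of infinitely many of them is in
  \<open>I\<close>: one takes the unions along an uncountable almost disjoint family of sets of indices. For the
  ideal of finite sets the \<open>s\<^sub>n\<close> can be distinct points of \<open>A\<close>. If the restriction of \<open>I\<close> to \<open>A\<close> is
  meager, they come from the argument of Jalali-Naini and Talagrand (\<open>meager_ideal_blocks\<close>): cover
  the restriction by nowhere dense sets \<open>D\<^sub>i\<close> and choose consecutive intervals, each with a
  pattern \<open>s\<^sub>n\<close>, so that a set with pattern \<open>s\<^sub>n\<close> on the \<open>n\<close>-th interval avoids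
  \<open>D\<^sub>0, \<dots>, D\<^sub>n\<close>. A set that shows infinitely many of the patterns avoids every \<open>D\<^sub>i\<close>.
\<close>

section \<open>Almost disjoint families\<close>

text \<open>
  The set of (codes of) nodes on the path that \<open>r\<close> follows through the binary tree of finite
  initial parts. Distinct paths separate at some level, so they share finitely many nodes.
\<close>
definition branch :: "nat set \<Rightarrow> nat set" where
  "branch r = (\<lambda>n. prod_encode (n, set_encode (r \<inter> {..<n}))) ` UNIV"

lemma infinite_branch: "infinite (branch r)"
proof -
  have "inj (\<lambda>n. prod_encode (n, set_encode (r \<inter> {..<n})))"
    by (auto simp: inj_on_def)
  then show ?thesis
    unfolding branch_def using range_inj_infinite by blast
qed

lemma finite_branch_Int:
  assumes "r \<noteq> s"
  shows "finite (branch r \<inter> branch s)"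
proof -
  obtain j where j: "(j \<in> r) \<noteq> (j \<in> s)"
    using assms by blast
  have "branch r \<inter> branch s \<subseteq> (\<lambda>n. prod_encode (n, set_encode (r \<inter> {..<n}))) ` {..j}"
  proof
    fix x
    assume "x \<in> branch r \<inter> branch s"
    then obtain n where n: "x = prod_encode (n, set_encode (r \<inter> {..<n}))"
        "set_encode (r \<inter> {..<n}) = set_encode (s \<inter> {..<n})"
      by (auto simp: branch_def)
    then have "r \<inter> {..<n} = s \<inter> {..<n}"
      by (simp add: set_encode_eq)
    with j have "n \<le> j"
      by (metis IntD1 IntI lessThan_iff not_le)
    with n show "x \<in> (\<lambda>n. prod_encode (n, set_encode (r \<inter> {..<n}))) ` {..j}"
      by blast
  qed
  then show ?thesis
    by (rule finite_subset) simp
qed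

lemma uncountable_UNIV_nat_set: "uncountable (UNIV :: nat set set)"
proof
  assume "countable (UNIV :: nat set set)"
  then have "range (from_nat_into (UNIV :: nat set set)) = Pow UNIV"
    by (simp add: range_from_nat_into)
  then show False
    using Cantors_theorem by blast
qed

text \<open>
  The members are the unions of the blocks along \<^term>\<open>branch r\<close>. Two of them share only the
  blocks with common index, because the blocks are disjoint, and these are finitely many.
\<close>
lemma almost_disjoint_family_from_blocks:
  fixes s :: "nat \<Rightarrow> nat set"
  assumes I: "nat_ideal I"
    and fin: "\<And>n. finite (s n)" and sub: "\<And>n. s n \<subseteq> A" and disj: "disjoint_family s"
    and fat: "\<And>X. infinite X \<Longrightarrow> (\<Union>n\<in>X. s n) \<notin> I"
  shows "\<exists>B :: nat set \<Rightarrow> nat set. (\<forall>r. B r \<subseteq> A \<and> B r \<notin> I) \<and> (\<forall>r t. r \<noteq> t \<longrightarrow> B r \<inter> B t \<in> I)"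
proof -
  define B where "B r = (\<Union>n\<in>branch r. s n)" for r
  have "B r \<inter> B t \<in> I" if "r \<noteq> t" for r t
  proof -
    have "B r \<inter> B t = (\<Union>n\<in>branch r \<inter> branch t. s n)"
    proof (intro equalityI subsetI)
      fix x
      assume "x \<in> B r \<inter> B t"
      then obtain m n where "m \<in> branch r" "x \<in> s m" "n \<in> branch t" "x \<in> s n"
        by (auto simp: B_def)
      moreover from this have "m = n"
        using disj unfolding disjoint_family_on_def by blast
      ultimately show "x \<in> (\<Union>n\<in>branch r \<inter> branch t. s n)"
        by blast
    qed (auto simp: B_def)
    then have "finite (B r \<inter> B t)"
      using finite_branch_Int[OF that] fin by simp
    then show ?thesis
      using I by (simp add: nat_ideal_def)
  qed
  moreover have "B r \<subseteq> A" "B r \<notin> I" for r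
    using sub fat[OF infinite_branch] by (auto simp: B_def)
  ultimately show ?thesis
    by (intro exI[of _ B]) simp
qed

section \<open>Blocks outside a meager ideal\<close>

text \<open>
  Nowhere density in the Cantor space of all subsets of \<open>nat\<close>, read off from basic open sets: a
  prefix \<open>p\<close> of length \<open>m\<close> always extends to a longer prefix \<open>q\<close> whose cylinder misses \<open>D\<close>.
\<close>
definition nowhere_dense_sets :: "nat set set \<Rightarrow> bool" where
  "nowhere_dense_sets D \<longleftrightarrow>
     (\<forall>m p. \<exists>m'\<ge>m. \<exists>q. q \<inter> {..<m} = p \<inter> {..<m} \<and>
        (\<forall>B. B \<inter> {..<m'} = q \<inter> {..<m'} \<longrightarrow> B \<notin> D))"

text \<open>
  Working with all subsets of \<open>nat\<close> rather than with functions on \<open>A\<close> lets the construction of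
  patterns below ignore \<open>A\<close>. The cylinder of \<open>p\<close> restricts to an open set \<open>U\<close>, which is not
  contained in the closure of \<open>C\<close>. A point of \<open>U\<close> outside the closure has a basic
  neighbourhood that misses \<open>C\<close>, and this neighbourhood restricts finitely many coordinates.
\<close>
lemma nowhere_dense_sets_vimage_char_fun:
  assumes C: "nowhere_dense_in (cantor_space A) C"
  shows "nowhere_dense_sets (char_fun A -` C)"
  unfolding nowhere_dense_sets_def
proof (intro allI)
  fix m :: nat and p :: "nat set"
  define T where "T = cantor_space A"
  define U where "U = (\<Pi>\<^sub>E n\<in>A. if n < m then {n \<in> p} else UNIV)"
  have "finite {n. (if n < m then {n \<in> p} else UNIV) \<noteq> UNIV}"
    by (rule finite_subset[of _ "{..<m}"]) (auto split: if_splits)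
  then have openU: "openin T U"
    unfolding T_def cantor_space_def U_def by (intro product_topology_basis) auto
  have "char_fun A p \<in> U"
    by (auto simp: char_fun_def U_def)
  moreover have "T interior_of (T closure_of C) = {}"
    using C by (simp add: nowhere_dense_in_def T_def)
  ultimately have "\<not> U \<subseteq> T closure_of C"
    using interior_of_maximal[OF _ openU] by blast
  then obtain x where x: "x \<in> U - T closure_of C"
    by blast
  have "openin T (U - T closure_of C)"
    using openU by (intro openin_diff closedin_closure_of)
  from product_topology_open_contains_basis[OF this[unfolded T_def cantor_space_def] x[unfolded T_def cantor_space_def]]
  obtain X where X: "x \<in> (\<Pi>\<^sub>E i\<in>A. X i)" "finite {i. X i \<noteq> UNIV}"
      "(\<Pi>\<^sub>E i\<in>A. X i) \<subseteq> U - T closure_of C"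
    unfolding T_def cantor_space_def by auto
  obtain k where k: "\<And>i. X i \<noteq> UNIV \<Longrightarrow> i < k"
    using X(2) finite_nat_set_iff_bounded by auto
  \<comment> \<open>Outside \<open>A\<close> the prefix has to follow \<open>p\<close>, since the new one must extend it.\<close>
  define q where "q = {n. if n \<in> A then x n else n \<in> p}"
  have xU: "x n = (n \<in> p)" if "n \<in> A" "n < m" for n
  proof -
    have "x n \<in> (if n < m then {n \<in> p} else UNIV)"
      using x that(1) unfolding U_def by blast
    then show ?thesis
      using that(2) by simp
  qed
  have "q \<inter> {..<m} = p \<inter> {..<m}"
    using xU by (auto simp: q_def)
  moreover have "B \<notin> char_fun A -` C" if B: "B \<inter> {..<max m k} = q \<inter> {..<max m k}" for B
  proof -
    have "char_fun A B n \<in> X n" if "n \<in> A" for n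
    proof (cases "n < k")
      case True
      moreover have "n \<in> B \<inter> {..<max m k} \<longleftrightarrow> n \<in> q \<inter> {..<max m k}"
        by (simp only: B)
      ultimately have "char_fun A B n = x n"
        using that by (simp add: char_fun_def q_def less_max_iff_disj)
      then show ?thesis
        using X(1) that by auto
    next
      case False
      then show ?thesis
        using k by blast
    qed
    then have "char_fun A B \<in> (\<Pi>\<^sub>E i\<in>A. X i)"
      by (auto simp: char_fun_def)
    moreover have "C \<subseteq> T closure_of C"
      using C unfolding nowhere_dense_in_def T_def by (intro closure_of_subset) simp
    ultimately show ?thesis
      using X(3) by auto
  qed
  ultimately show "\<exists>m'\<ge>m. \<exists>q. q \<inter> {..<m} = p \<inter> {..<m} \<and>
      (\<forall>B. B \<inter> {..<m'} = q \<inter> {..<m'} \<longrightarrow> B \<notin> char_fun A -` C)"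
    by (intro exI[of _ "max m k"]) auto
qed

text \<open>
  A single pattern \<open>s\<close> can serve several prefixes \<open>t\<close> and several sets \<^term>\<open>D i\<close>: treat the pairs
  \<open>(t, i)\<close> one after the other, each time lengthening the pattern. Lengthening does not harm the pairs
  treated before.
\<close>
lemma avoiding_block_for_finitely_many_prefixes:
  assumes D: "\<And>i. nowhere_dense_sets (D i)" and T: "finite T"
  shows "\<exists>m'\<ge>m. \<exists>s\<subseteq>{m..<m'}. \<forall>t i B.
           (t, i) \<in> T \<longrightarrow> B \<inter> {..<m} = t \<longrightarrow> B \<inter> {m..<m'} = s \<longrightarrow> B \<notin> D i"
  using T
proof induction
  case empty
  show ?case
    by (intro exI[of _ m]) auto
next
  case (insert a T)
  obtain t i where a: "a = (t, i)"
    by (cases a)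
  from insert.IH obtain m1 s1 where 1: "m1 \<ge> m" "s1 \<subseteq> {m..<m1}"
      "\<And>t i B. (t, i) \<in> T \<Longrightarrow> B \<inter> {..<m} = t \<Longrightarrow> B \<inter> {m..<m1} = s1 \<Longrightarrow> B \<notin> D i"
    by blast
  obtain m2 q where 2: "m2 \<ge> m1" "q \<inter> {..<m1} = (t \<inter> {..<m} \<union> s1) \<inter> {..<m1}"
      "\<And>B. B \<inter> {..<m2} = q \<inter> {..<m2} \<Longrightarrow> B \<notin> D i"
    using D[of i] unfolding nowhere_dense_sets_def by meson
  have "{..<m1} = {..<m} \<union> {m..<m1}" "{..<m} \<inter> {m..<m1} = {}"
    using 1(1) by auto
  then have qm: "q \<inter> {..<m} = t \<inter> {..<m}" and q1: "q \<inter> {m..<m1} = s1"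
    using 1(2) 2(2) by blast+
  have new: "B \<notin> D i" if "B \<inter> {..<m} = t" "B \<inter> {m..<m2} = q \<inter> {m..<m2}" for B
  proof (rule 2(3))
    have split: "{..<m2} = {..<m} \<union> {m..<m2}"
      using 1(1) 2(1) by auto
    show "B \<inter> {..<m2} = q \<inter> {..<m2}"
      using that qm unfolding split by blast
  qed
  have old: "B \<notin> D i'" if "(t', i') \<in> T" "B \<inter> {..<m} = t'"
      "B \<inter> {m..<m2} = q \<inter> {m..<m2}" for B t' i'
  proof (rule 1(3)[OF that(1,2)])
    have "{m..<m1} \<subseteq> {m..<m2}"
      using 2(1) by auto
    then show "B \<inter> {m..<m1} = s1"
      using that(3) q1 by blast
  qed
  show ?case
  proof (intro exI[of _ m2] conjI exI[of _ "q \<inter> {m..<m2}"] allI impI)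
    show "m \<le> m2"
      using 1(1) 2(1) by (rule order_trans)
    show "B \<notin> D i'" if "(t', i') \<in> insert a T" "B \<inter> {..<m} = t'"
        "B \<inter> {m..<m2} = q \<inter> {m..<m2}" for t' i' B
      using that new old unfolding a by blast
  qed simp
qed

text \<open>
  The pattern at stage \<open>n\<close> is chosen for all \<open>2\<^sup>m\<close> prefixes below its left end \<open>m\<close> and for
  all \<open>i \<le> n\<close>. Hence agreement with \<^term>\<open>s n\<close> alone keeps a set out of \<^term>\<open>D i\<close> for \<open>i \<le> n\<close>,
  and agreement with infinitely many patterns keeps it out of every \<^term>\<open>D i\<close>.
\<close>
lemma avoiding_blocks:
  fixes D :: "nat \<Rightarrow> nat set set"
  assumes D: "\<And>i. nowhere_dense_sets (D i)"
  obtains k :: "nat \<Rightarrow> nat" and s :: "nat \<Rightarrow> nat set"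
  where "mono k" "\<And>n. s n \<subseteq> {k n..<k (Suc n)}"
    "\<And>B i. infinite {n. B \<inter> {k n..<k (Suc n)} = s n} \<Longrightarrow> B \<notin> D i"
proof -
  have "\<exists>m'\<ge>m. \<exists>s\<subseteq>{m..<m'}. \<forall>i\<le>n. \<forall>B. B \<inter> {m..<m'} = s \<longrightarrow> B \<notin> D i" for m n :: nat
  proof -
    have "\<exists>m'\<ge>m. \<exists>s\<subseteq>{m..<m'}. \<forall>t i B. (t, i) \<in> Pow {..<m} \<times> {..n} \<longrightarrow>
        B \<inter> {..<m} = t \<longrightarrow> B \<inter> {m..<m'} = s \<longrightarrow> B \<notin> D i"
      by (rule avoiding_block_for_finitely_many_prefixes[OF D]) simp
    then obtain m' s where m': "m' \<ge> m" "s \<subseteq> {m..<m'}"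
        and avoid: "\<forall>t i B. (t, i) \<in> Pow {..<m} \<times> {..n} \<longrightarrow>
           B \<inter> {..<m} = t \<longrightarrow> B \<inter> {m..<m'} = s \<longrightarrow> B \<notin> D i"
      by blast
    have "B \<notin> D i" if "i \<le> n" "B \<inter> {m..<m'} = s" for i B
      using avoid[rule_format, of "B \<inter> {..<m}" i B] that by simp
    with m' show ?thesis
      by blast
  qed
  then obtain f g where f: "\<And>m n. f m n \<ge> m" and g: "\<And>m n. g m n \<subseteq> {m..<f m n}"
      and fg: "\<And>m n i B. i \<le> n \<Longrightarrow> B \<inter> {m..<f m n} = g m n \<Longrightarrow> B \<notin> D i"
    by metis
  define k where "k = rec_nat 0 (\<lambda>n m. f m n)"
  have k: "k (Suc n) = f (k n) n" for n
    by (simp add: k_def)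
  define s where "s n = g (k n) n" for n
  show thesis
  proof
    show "mono k"
      using f by (simp add: mono_iff_le_Suc k)
    show "s n \<subseteq> {k n..<k (Suc n)}" for n
      using g by (simp add: s_def k)
    show "B \<notin> D i" if "infinite {n. B \<inter> {k n..<k (Suc n)} = s n}" for B i
    proof -
      have "\<exists>n\<ge>i. n \<in> {n. B \<inter> {k n..<k (Suc n)} = s n}"
        using that unfolding infinite_nat_iff_unbounded_le ..
      then obtain n where "n \<ge> i" "B \<inter> {k n..<k (Suc n)} = s n"
        by auto
      then show ?thesis
        using fg[of i n B "k n"] by (simp add: s_def k)
    qed
  qed
qed

text \<open>
  The blocks are the patterns of \<open>avoiding_blocks\<close>, cut down to \<open>A\<close>. A union \<open>B\<close> of infinitely many
  patterns shows each of them on its own interval, so it avoids the nowhere dense sets that cover the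
  restriction of \<open>I\<close> to \<open>A\<close>. Cutting \<open>B\<close> down to \<open>A\<close> does not change its characteristic
  function on \<open>A\<close>.
\<close>
lemma meager_ideal_blocks:
  assumes I: "nat_ideal I"
    and meager: "meager_in (cantor_space A) (char_fun A ` restrict_ideal I A)"
  shows "\<exists>s :: nat \<Rightarrow> nat set. (\<forall>n. finite (s n) \<and> s n \<subseteq> A) \<and> disjoint_family s \<and>
           (\<forall>X. infinite X \<longrightarrow> (\<Union>n\<in>X. s n) \<notin> I)"
proof -
  from meager obtain F where meager_F: "countable F \<and> (\<forall>C\<in>F. nowhere_dense_in (cantor_space A) C) \<and>
      char_fun A ` restrict_ideal I A = \<Union>F"
    unfolding meager_in_def ..
  then have F: "countable F" "\<And>C. C \<in> F \<Longrightarrow> nowhere_dense_in (cantor_space A) C"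
      "char_fun A ` restrict_ideal I A = \<Union>F"
    by simp_all
  have "{} \<in> restrict_ideal I A"
    using nat_idealD(1)[OF I] by (auto simp: restrict_ideal_def)
  then have "F \<noteq> {}"
    using F(3) by auto
  define D where "D i = char_fun A -` from_nat_into F i" for i
  have "nowhere_dense_sets (D i)" for i
    unfolding D_def
    by (intro nowhere_dense_sets_vimage_char_fun F(2) from_nat_into \<open>F \<noteq> {}\<close>)
  then obtain k s where k: "mono k" and s: "\<And>n. s n \<subseteq> {k n..<k (Suc n)}"
      and avoid: "\<And>B i. infinite {n. B \<inter> {k n..<k (Suc n)} = s n} \<Longrightarrow> B \<notin> D i"
    using avoiding_blocks[of D] by blast
  have block_disj: "{k m..<k (Suc m)} \<inter> {k n..<k (Suc n)} = {}" if "m \<noteq> n" for m n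
  proof -
    have "k (Suc m) \<le> k n \<or> k (Suc n) \<le> k m"
      using that monoD[OF k, of "Suc m" n] monoD[OF k, of "Suc n" m] by linarith
    then show ?thesis
      by auto
  qed
  have s_disj: "s m \<inter> {k n..<k (Suc n)} = {}" if "m \<noteq> n" for m n
    using block_disj[OF that] s[of m] by blast
  have "(\<Union>n\<in>X. s n \<inter> A) \<notin> I" if "infinite X" for X
  proof
    assume in_I: "(\<Union>n\<in>X. s n \<inter> A) \<in> I"
    define B where "B = (\<Union>n\<in>X. s n)"
    have "B \<inter> {k n..<k (Suc n)} = s n" if "n \<in> X" for n
    proof (intro equalityI subsetI)
      fix x
      assume "x \<in> B \<inter> {k n..<k (Suc n)}"
      then obtain m where m: "x \<in> s m" "x \<in> {k n..<k (Suc n)}"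
        by (auto simp: B_def)
      then have "m = n"
        using s_disj[of m n] by blast
      with m show "x \<in> s n"
        by simp
    next
      fix x
      assume "x \<in> s n"
      then show "x \<in> B \<inter> {k n..<k (Suc n)}"
        using that s[of n] by (auto simp: B_def)
    qed
    then have "X \<subseteq> {n. B \<inter> {k n..<k (Suc n)} = s n}"
      by blast
    then have "B \<notin> D i" for i
      using avoid \<open>infinite X\<close> infinite_super by blast
    moreover have "\<exists>i. C = from_nat_into F i" if "C \<in> F" for C
      using that F(1) \<open>F \<noteq> {}\<close> by (metis from_nat_into_surj)
    ultimately have "char_fun A B \<notin> \<Union>F"
      by (auto simp: D_def)
    moreover have "B \<inter> A \<in> restrict_ideal I A"
    proof -
      have "B \<inter> A = A \<inter> (\<Union>n\<in>X. s n \<inter> A)"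
        by (auto simp: B_def)
      with in_I show ?thesis
        unfolding restrict_ideal_def by blast
    qed
    then have "char_fun A (B \<inter> A) \<in> \<Union>F"
      using F(3) by blast
    moreover have "char_fun A (B \<inter> A) = char_fun A B"
      by (auto simp: char_fun_def restrict_def)
    ultimately show False
      by simp
  qed
  moreover have "finite (s n)" for n
    using s[of n] by (rule finite_subset) simp
  moreover have "disjoint_family (\<lambda>n. s n \<inter> A)"
    unfolding disjoint_family_on_def
  proof (intro ballI impI)
    fix m n :: nat
    assume "m \<noteq> n"
    then show "s m \<inter> A \<inter> (s n \<inter> A) = {}"
      using s[of n] s_disj[of m n] by blast
  qed
  ultimately show ?thesis
    by (intro exI[of _ "\<lambda>n. s n \<inter> A"]) auto
qed

lemma infinite_set_blocks:
  assumes "infinite A"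
  shows "\<exists>s :: nat \<Rightarrow> nat set. (\<forall>n. finite (s n) \<and> s n \<subseteq> A) \<and> disjoint_family s \<and>
           (\<forall>X. infinite X \<longrightarrow> (\<Union>n\<in>X. s n) \<notin> Fin)"
proof -
  obtain f :: "nat \<Rightarrow> nat" where f: "inj f" "range f \<subseteq> A"
    using infinite_countable_subset[OF assms] by blast
  have "infinite (\<Union>n\<in>X. {f n})" if "infinite X" for X
    using that f(1) by (metis UNION_singleton_eq_range finite_imageD inj_on_subset subset_UNIV)
  then have "\<forall>X. infinite X \<longrightarrow> (\<Union>n\<in>X. {f n}) \<notin> Fin"
    by (simp add: Fin_def)
  moreover have "disjoint_family (\<lambda>n. {f n})" "\<And>n. finite {f n} \<and> {f n} \<subseteq> A"
    using f by (auto simp: disjoint_family_on_def inj_def)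
  ultimately show ?thesis
    by (intro exI[of _ "\<lambda>n. {f n}"]) simp
qed

section \<open>Indicator sequences\<close>

definition indic :: "nat set \<Rightarrow> nat \<Rightarrow>\<^sub>C 'k::real_normed_field" where
  "indic B = Bcontfun (\<lambda>n. of_bool (n \<in> B))"

lemma apply_indic [simp]:
  "apply_bcontfun (indic B :: nat \<Rightarrow>\<^sub>C 'k::real_normed_field) n = of_bool (n \<in> B)"
proof -
  have "(\<lambda>n. of_bool (n \<in> B) :: 'k) \<in> bcontfun"
    by (rule bcontfun_normI[where b = 1]) auto
  then show ?thesis
    unfolding indic_def by (simp only: Bcontfun_inverse)
qed

lemma indic_in_c0_ideal_iff:
  assumes I: "nat_ideal I"
  shows "(indic B :: nat \<Rightarrow>\<^sub>C 'k::real_normed_field) \<in> c0_ideal I \<longleftrightarrow> B \<in> I"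
proof
  assume "(indic B :: nat \<Rightarrow>\<^sub>C 'k) \<in> c0_ideal I"
  then have "{n. norm (apply_bcontfun (indic B :: nat \<Rightarrow>\<^sub>C 'k) n) \<ge> 1} \<in> I"
    unfolding c0_ideal_def using zero_less_one by blast
  moreover have "{n. norm (apply_bcontfun (indic B :: nat \<Rightarrow>\<^sub>C 'k) n) \<ge> 1} = B"
    by auto
  ultimately show "B \<in> I"
    by simp
next
  assume "B \<in> I"
  moreover have "{n. norm (apply_bcontfun (indic B :: nat \<Rightarrow>\<^sub>C 'k) n) \<ge> \<epsilon>} \<subseteq> B" if "\<epsilon> > 0" for \<epsilon>
    using that by auto
  ultimately show "(indic B :: nat \<Rightarrow>\<^sub>C 'k) \<in> c0_ideal I"
    unfolding c0_ideal_def using nat_idealD(2)[OF I] by blast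
qed

lemma apply_bcontfun_sum:
  "apply_bcontfun (\<Sum>r\<in>R. f r :: nat \<Rightarrow>\<^sub>C 'k::real_normed_field) n = (\<Sum>r\<in>R. apply_bcontfun (f r) n)"
  by (induction R rule: infinite_finite_induct) auto

text \<open>
  At each coordinate at most one summand is nonzero.
\<close>
lemma norm_sum_disjoint_indic_le:
  fixes c :: "'r \<Rightarrow> 'k::real_normed_field"
  assumes disj: "disjoint_family_on B R" and c: "\<And>r. r \<in> R \<Longrightarrow> norm (c r) \<le> 1"
  shows "norm (\<Sum>r\<in>R. linf_scale (c r) (indic (B r))) \<le> 1"
proof (rule norm_bound)
  fix n
  have eq: "apply_bcontfun (\<Sum>r\<in>R. linf_scale (c r) (indic (B r))) n =
      (\<Sum>r\<in>R. c r * of_bool (n \<in> B r))"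
    by (simp add: apply_bcontfun_sum)
  show "norm (apply_bcontfun (\<Sum>r\<in>R. linf_scale (c r) (indic (B r))) n) \<le> 1"
  proof (cases "finite R \<and> (\<exists>r\<in>R. n \<in> B r)")
    case True
    then obtain r where r: "r \<in> R" "n \<in> B r" and R: "finite R"
      by blast
    have "n \<in> B t \<longleftrightarrow> t = r" if "t \<in> R" for t
      using disj r that unfolding disjoint_family_on_def by blast
    then have "(\<Sum>t\<in>R. c t * of_bool (n \<in> B t)) = (\<Sum>t\<in>R. if t = r then c r else 0)"
      by (intro sum.cong) auto
    then show ?thesis
      using r R c by (simp add: eq)
  next
    case False
    then have "(\<Sum>t\<in>R. c t * of_bool (n \<in> B t)) = 0"
      by (cases "finite R") (auto intro: sum.neutral)
    then show ?thesis
      unfolding eq by simp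
  qed
qed

section \<open>Operators that vanish on the smaller space\<close>

text \<open>
  Coefficients of modulus one rotate the values at coordinate \<open>n\<close> to nonnegative numbers, so that
  the sum becomes one coordinate of \<open>Q y\<close> for a vector \<open>y\<close> of norm at most one.
\<close>
lemma sum_norm_disjoint_indic_le:
  fixes Q :: "(nat \<Rightarrow>\<^sub>C 'k::real_normed_field) \<Rightarrow> (nat \<Rightarrow>\<^sub>C 'k)"
  assumes X: "linf.subspace X"
    and add: "\<And>x y. x \<in> X \<Longrightarrow> y \<in> X \<Longrightarrow> Q (x + y) = Q x + Q y"
    and scale: "\<And>c x. x \<in> X \<Longrightarrow> Q (linf_scale c x) = linf_scale c (Q x)"
    and bound: "\<And>x. x \<in> X \<Longrightarrow> norm (Q x) \<le> K * norm x" and K: "K \<ge> 0"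
    and R: "finite R" and disj: "disjoint_family_on B R"
    and B: "\<And>r. r \<in> R \<Longrightarrow> indic (B r) \<in> X"
  shows "(\<Sum>r\<in>R. norm (apply_bcontfun (Q (indic (B r))) n)) \<le> K"
proof -
  define z where "z r = apply_bcontfun (Q (indic (B r))) n" for r
  \<comment> \<open>If \<open>z r = 0\<close>, then \<open>c r = 0\<close> by division by zero, and \<open>c r * z r = |z r|\<close> still holds.\<close>
  define c where "c r = of_real (norm (z r)) / z r" for r
  define y where "y = (\<Sum>r\<in>R. linf_scale (c r) (indic (B r)))"
  have "norm (c r) \<le> 1" and cz: "c r * z r = of_real (norm (z r))" for r
    by (auto simp: c_def norm_divide)
  then have y1: "norm y \<le> 1"
    unfolding y_def by (intro norm_sum_disjoint_indic_le disj)
  have mem: "linf_scale (c r) (indic (B r)) \<in> X" if "r \<in> R" for r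
    using B[OF that] X by (rule linf.subspace_scale[rotated])
  have Q0: "Q 0 = 0"
    using add[of 0 0] linf.subspace_0[OF X] by simp
  have "Q (\<Sum>r\<in>S. linf_scale (c r) (indic (B r))) = (\<Sum>r\<in>S. linf_scale (c r) (Q (indic (B r))))"
    if "S \<subseteq> R" for S
    using finite_subset[OF that R] that
  proof (induction S)
    case empty
    show ?case
      by (simp add: Q0)
  next
    case (insert a S)
    have "(\<Sum>r\<in>S. linf_scale (c r) (indic (B r))) \<in> X"
      using insert.prems mem by (intro linf.subspace_sum[OF X]) auto
    then show ?case
      using insert mem scale B by (simp add: add)
  qed
  then have "Q y = (\<Sum>r\<in>R. linf_scale (c r) (Q (indic (B r))))"
    unfolding y_def by blast
  then have "apply_bcontfun (Q y) n = (\<Sum>r\<in>R. of_real (norm (z r)))"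
    by (simp add: apply_bcontfun_sum cz flip: z_def)
  also have "\<dots> = of_real (\<Sum>r\<in>R. norm (z r))"
    by simp
  finally have "(\<Sum>r\<in>R. norm (z r)) = norm (apply_bcontfun (Q y) n)"
    by (simp add: sum_nonneg del: of_real_sum)
  also have "\<dots> \<le> norm (Q y)"
    by (rule norm_bounded)
  also have "\<dots> \<le> K * norm y"
    unfolding y_def using mem by (intro bound linf.subspace_sum[OF X])
  also have "\<dots> \<le> K"
    using y1 K by (simp add: mult_left_le)
  finally show ?thesis
    by (simp add: z_def)
qed

text \<open>
  Removing from \<^term>\<open>B r\<close> its intersections with finitely many other members changes the indicator
  by an element of \<^term>\<open>c0_ideal I\<close>, where \<open>Q\<close> vanishes. Therefore the estimate for disjoint families
  applies, and a family of nonnegative numbers with bounded finite sums has countable support. The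
  supports for all coordinates together do not exhaust an uncountable index type.
\<close>
lemma vanishing_operator_kills_almost_disjoint_member:
  fixes Q :: "(nat \<Rightarrow>\<^sub>C 'k::real_normed_field) \<Rightarrow> (nat \<Rightarrow>\<^sub>C 'k)" and B :: "'r \<Rightarrow> nat set"
  assumes I: "nat_ideal I" and J: "nat_ideal J"
    and add: "\<And>x y. x \<in> c0_ideal J \<Longrightarrow> y \<in> c0_ideal J \<Longrightarrow> Q (x + y) = Q x + Q y"
    and scale: "\<And>c x. x \<in> c0_ideal J \<Longrightarrow> Q (linf_scale c x) = linf_scale c (Q x)"
    and bound: "\<And>x. x \<in> c0_ideal J \<Longrightarrow> norm (Q x) \<le> K * norm x" and K: "K \<ge> 0"
    and kills: "\<And>x. x \<in> c0_ideal I \<Longrightarrow> Q x = 0"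
    and unc: "uncountable (UNIV :: 'r set)"
    and B: "\<And>r. B r \<in> J" and ad: "\<And>r t. r \<noteq> t \<Longrightarrow> B r \<inter> B t \<in> I"
  shows "\<exists>r. Q (indic (B r)) = 0"
proof -
  have sum_le: "(\<Sum>r\<in>R. norm (apply_bcontfun (Q (indic (B r))) n)) \<le> K" if R: "finite R" for R n
  proof -
    define G where "G r = (\<Union>t\<in>R - {r}. B r \<inter> B t)" for r
    have G: "G r \<in> I" for r
    proof -
      have "(\<Union>t\<in>S. B r \<inter> B t) \<in> I" if "finite S" "r \<notin> S" for S
        using that by induction (auto intro!: nat_idealD(3)[OF I] nat_idealD(1)[OF I] ad)
      then show ?thesis
        using R by (simp add: G_def)
    qed
    have BG: "B r - G r \<in> J" for r
      using nat_idealD(2)[OF J B] by blast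
    have "Q (indic (B r)) = Q (indic (B r - G r))" for r
    proof -
      have "indic (B r) = (indic (B r - G r) + indic (G r) :: nat \<Rightarrow>\<^sub>C 'k)"
        by (rule bcontfun_eqI) (auto simp: G_def)
      moreover have "G r \<in> J"
        using nat_idealD(2)[OF J B, of "G r" r] by (auto simp: G_def)
      ultimately show ?thesis
        using add[of "indic (B r - G r)" "indic (G r)"] kills[of "indic (G r)"] BG[of r] G[of r]
        by (simp add: indic_in_c0_ideal_iff I J)
    qed
    moreover have "disjoint_family_on (\<lambda>r. B r - G r) R"
      by (auto simp: disjoint_family_on_def G_def)
    ultimately show ?thesis
      using sum_norm_disjoint_indic_le[OF c0_ideal_subspace[OF J], of Q K R "\<lambda>r. B r - G r" n]
        add scale bound K R BG by (simp add: indic_in_c0_ideal_iff J)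
  qed
  have "countable {r. apply_bcontfun (Q (indic (B r))) n \<noteq> 0}" for n
  proof -
    have "(\<lambda>r. norm (apply_bcontfun (Q (indic (B r))) n)) summable_on UNIV"
      using sum_le
      by (intro nonneg_bounded_partial_sums_imp_summable_on[where C = K]
          eventually_finite_subsets_at_top_weakI) auto
    from summable_countable_real[OF this] show ?thesis
      by simp
  qed
  then have "countable (\<Union>n. {r. apply_bcontfun (Q (indic (B r))) n \<noteq> 0})"
    by simp
  then have "(\<Union>n. {r. apply_bcontfun (Q (indic (B r))) n \<noteq> 0}) \<noteq> UNIV"
    using unc by metis
  then obtain r where "\<And>n. apply_bcontfun (Q (indic (B r))) n = 0"
    by blast
  then have "Q (indic (B r)) = 0"
    by (intro bcontfun_eqI) simp
  then show ?thesis ..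
qed

text \<open>
  Applied to \<open>Q x = x - P x\<close>, the previous lemma yields an indicator that \<open>P\<close> fixes, although its
  set lies outside \<open>I\<close>.
\<close>
lemma not_complemented_if_blocks:
  assumes I: "nat_ideal I" and J: "nat_ideal J" and sub: "I \<subseteq> J" and A: "A \<in> J"
    and blocks: "\<exists>s :: nat \<Rightarrow> nat set. (\<forall>n. finite (s n) \<and> s n \<subseteq> A) \<and> disjoint_family s \<and>
           (\<forall>X. infinite X \<longrightarrow> (\<Union>n\<in>X. s n) \<notin> I)"
  shows "\<not> complemented_in linf_scale
           (c0_ideal I :: (nat \<Rightarrow>\<^sub>C 'k::real_normed_field) set) (c0_ideal J)"
proof
  assume "complemented_in linf_scale (c0_ideal I :: (nat \<Rightarrow>\<^sub>C 'k) set) (c0_ideal J)"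
  then obtain P :: "(nat \<Rightarrow>\<^sub>C 'k) \<Rightarrow> (nat \<Rightarrow>\<^sub>C 'k)" where
      P: "(\<forall>x\<in>c0_ideal J. \<forall>y\<in>c0_ideal J. P (x + y) = P x + P y) \<and>
        (\<forall>c. \<forall>x\<in>c0_ideal J. P (linf_scale c x) = linf_scale c (P x)) \<and>
        (\<exists>K. \<forall>x\<in>c0_ideal J. norm (P x) \<le> K * norm x) \<and>
        (\<forall>x\<in>c0_ideal J. P (P x) = P x) \<and>
        P ` c0_ideal J = c0_ideal I"
    unfolding complemented_in_def ..
  then have "\<exists>K. \<forall>x\<in>c0_ideal J. norm (P x) \<le> K * norm x"
    by (elim conjE)
  then obtain K where Pbound: "\<And>x. x \<in> c0_ideal J \<Longrightarrow> norm (P x) \<le> K * norm x"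
    by blast
  have Padd: "\<And>x y. x \<in> c0_ideal J \<Longrightarrow> y \<in> c0_ideal J \<Longrightarrow> P (x + y) = P x + P y"
    and Pscale: "\<And>c x. x \<in> c0_ideal J \<Longrightarrow> P (linf_scale c x) = linf_scale c (P x)"
    and Pidem: "\<And>x. x \<in> c0_ideal J \<Longrightarrow> P (P x) = P x"
    and Prange: "P ` c0_ideal J = c0_ideal I"
    using P by simp_all
  from blocks obtain s :: "nat \<Rightarrow> nat set" where s: "\<And>n. finite (s n)" "\<And>n. s n \<subseteq> A" "disjoint_family s"
      "\<And>X. infinite X \<Longrightarrow> (\<Union>n\<in>X. s n) \<notin> I"
    by blast
  obtain B :: "nat set \<Rightarrow> nat set" where
      B_family: "(\<forall>r. B r \<subseteq> A \<and> B r \<notin> I) \<and> (\<forall>r t. r \<noteq> t \<longrightarrow> B r \<inter> B t \<in> I)"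
    using almost_disjoint_family_from_blocks[OF I s] ..
  then have B: "\<And>r. B r \<subseteq> A" "\<And>r. B r \<notin> I"
      and ad: "\<And>r t. r \<noteq> t \<Longrightarrow> B r \<inter> B t \<in> I"
    by simp_all
  have BJ: "B r \<in> J" for r
    using nat_idealD(2)[OF J A B(1)] .
  have "\<exists>r. indic (B r) - P (indic (B r)) = 0"
  proof (rule vanishing_operator_kills_almost_disjoint_member
      [where Q = "\<lambda>x. x - P x" and K = "1 + \<bar>K\<bar>", OF I J _ _ _ _ _ uncountable_UNIV_nat_set BJ ad])
    show "norm (x - P x) \<le> (1 + \<bar>K\<bar>) * norm x" if "x \<in> c0_ideal J" for x
    proof -
      have "norm (x - P x) \<le> norm x + norm (P x)"
        by (rule norm_triangle_ineq4)
      also have "\<dots> \<le> norm x + \<bar>K\<bar> * norm x"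
        using Pbound[OF that] mult_right_mono[OF abs_ge_self[of K] norm_ge_zero[of x]] by simp
      finally show ?thesis
        by (simp add: algebra_simps)
    qed
    show "x - P x = 0" if "x \<in> c0_ideal I" for x
    proof -
      from that have "x \<in> P ` c0_ideal J"
        by (simp only: Prange)
      then obtain y where "y \<in> c0_ideal J" "x = P y"
        by blast
      then show ?thesis
        using Pidem[of y] by simp
    qed
    show "x + y - P (x + y) = x - P x + (y - P y)" if "x \<in> c0_ideal J" "y \<in> c0_ideal J" for x y
      using Padd[OF that] by simp
    show "linf_scale c x - P (linf_scale c x) = linf_scale c (x - P x)" if "x \<in> c0_ideal J" for c x
      using Pscale[OF that] by (simp add: linf.scale_right_diff_distrib)
  qed auto
  then obtain r where "indic (B r) = P (indic (B r))"
    by auto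
  moreover have "P (indic (B r)) \<in> c0_ideal I"
    using Prange BJ[of r] by (auto simp: indic_in_c0_ideal_iff[OF J])
  ultimately have "B r \<in> I"
    using indic_in_c0_ideal_iff[OF I] by metis
  then show False
    using B(2) by blast
qed

theorem corollary7p6:
  shows "(\<forall>I J. proper_nat_ideal I \<and> proper_nat_ideal J \<and> I \<subset> J \<and> everywhere_meager I \<longrightarrow>
            \<not> complemented_in linf_scale
                (c0_ideal I :: (nat \<Rightarrow>\<^sub>C 'k::{real_normed_field, banach}) set) (c0_ideal J))
       \<and> (\<forall>J. nat_ideal J \<and> Fin \<subset> J \<longrightarrow>
            \<not> complemented_in linf_scale
                (c0_ideal Fin :: (nat \<Rightarrow>\<^sub>C 'k) set) (c0_ideal J))"
proof (intro conjI allI impI)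
  fix I J
  assume "proper_nat_ideal I \<and> proper_nat_ideal J \<and> I \<subset> J \<and> everywhere_meager I"
  then have IJ: "nat_ideal I" "nat_ideal J" "I \<subseteq> J" and meager: "everywhere_meager I" and "\<exists>A. A \<in> J \<and> A \<notin> I"
    unfolding proper_nat_ideal_def by auto
  then obtain A where "A \<in> J" "A \<notin> I"
    by blast
  with meager show "\<not> complemented_in linf_scale (c0_ideal I :: (nat \<Rightarrow>\<^sub>C 'k) set) (c0_ideal J)"
    by (intro not_complemented_if_blocks[OF IJ] meager_ideal_blocks[OF IJ(1)])
      (auto simp: everywhere_meager_def)
next
  fix J
  assume J: "nat_ideal J \<and> Fin \<subset> J"
  then obtain A where A: "A \<in> J" "infinite A"
    by (auto simp: Fin_def)
  have "nat_ideal Fin"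
    by (auto simp: nat_ideal_def Fin_def intro: finite_subset)
  with J A show "\<not> complemented_in linf_scale (c0_ideal Fin :: (nat \<Rightarrow>\<^sub>C 'k) set) (c0_ideal J)"
    by (intro not_complemented_if_blocks infinite_set_blocks) auto
qed

end
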